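(* Let $n\ge 2$ and consider a normal generalized braid theory with braid group $gB_n$ on $n$ strands. The set $qgB_n$ of all quasitoric normal generalized braids on $n$ strands forms a subgroup of $gB_n$ under concatenation.
   Context: **Generalized braid theory.** Fix a finite set $T$ of tags (crossing types). Each tag $a$ has a negative version $\bar a$ (with $\bar{\bar a}=a$; possibly $\bar a=a$). A generalized braid diagram on $n$ strands is a union of $n$ monotonic strands in $\mathbb{R}\times[0,1]$ with boundary $Q_n\times\{0,1\}$ ($Q_n\subset\mathbb{R}$ a set of $n$ points), whose crossings are finitely many transverse double points, each labelled by some $a$ or $\bar a$, considered up to planar isotopy fixing the end points. Write $a_i$, $\bar a_i$ ($1\le i\le n-1$) for the diagram with a single crossing, between positions $i$ and $i+1$, labelled $a$, resp. $\bar a$. Every diagram is a product (concatenation) of such elementary diagrams; planar isotopy gives $a_ib_j=b_ja_i$ for $|i-j|>1$ and all labels $a,b$. A braid theory specifies which of the following R-moves are allowed: $R_2(a)$: $a_i\bar a_i=1=\bar a_ia_i$; third moves, for specified triples of labels $a,b,c$: $a_ib_{i+1}c_i=c_{i+1}b_ia_{i+1}$; possibly commutation moves, for specified pairs of labels: $a_ib_i=b_ia_i$ (each for all admissible $i$). A braid is an equivalence class of diagrams under allowed moves. The theory is regular if $R_2(a)$ is allowed for every tag $a$; then the braids on $n$ strands form a group $gB_n$ under concatenation, with $\bar a_i=a_i^{-1}$. It is normal if it is regular and has a dominant tag $x$, meaning that for all labels $a$ (including $a=x$) and $1\le i\le n-2$, $$x_ix_{i+1}a_i=a_{i+1}x_ix_{i+1},\qquad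 x_{i+1}x_ia_{i+1}=a_ix_{i+1}x_i .$$ So $gB_n$ is the group generated by all $a_i$ ($a\in T$, $1\le i\le n-1$), with relations the far commutations and those of the allowed moves. **Quasitoric braid.** A braid on $p$ strands is quasitoric (of type $(p,q)$, for some positive integer $q$), also called $p$-quasitoric, if it can be written as $\beta_1\beta_2\cdots\beta_q$ with $\beta_j=y_{j,p-1}y_{j,p-2}\cdots y_{j,1}$, where each $y_{j,i}\in\{a_i,\bar a_i : a\in T\}$. *)

theory Defs
  imports "HOL-Algebra.Group"
begin

text \<open>
  The data of a braid theory: the set of tags, the map sending a label to its negative version,
  and the allowed second moves (by tag), third moves (by triples of labels) and commutation
  moves (by pairs of labels).
\<close>

record 'a braid_data =
  tags :: "'a set"
  neg :: "'a \<Rightarrow> 'a"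
  R2_moves :: "'a set"
  R3_moves :: "('a \<times> 'a \<times> 'a) set"
  comm_moves :: "('a \<times> 'a) set"

definition labels :: "('a, 'm) braid_data_scheme \<Rightarrow> 'a set" where
  "labels B = tags B \<union> neg B ` tags B"

locale braid_theory =
  fixes B :: "('a, 'm) braid_data_scheme"
  assumes finite_tags: "finite (tags B)"
    and neg_neg: "a \<in> tags B \<Longrightarrow> neg B (neg B a) = a"
    and R2_tags: "R2_moves B \<subseteq> tags B"
    and R3_labels: "R3_moves B \<subseteq> labels B \<times> labels B \<times> labels B"
    and comm_labels: "comm_moves B \<subseteq> labels B \<times> labels B"

text \<open>
  A diagram on \<open>n\<close> strands is a word in the elementary diagrams; the letter \<open>(a, i)\<close> is the
  single crossing with label \<open>a\<close> between the positions \<open>i\<close> and \<open>i + 1\<close>. Planar isotopy is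
  not built into diagrams but appears as the far commutation \<open>far\<close> among the moves below.
\<close>

type_synonym 'a word = "('a \<times> nat) list"

definition diagrams :: "('a, 'm) braid_data_scheme \<Rightarrow> nat \<Rightarrow> 'a word set" where
  "diagrams B n = lists (labels B \<times> {1..<n})"

inductive move :: "('a, 'm) braid_data_scheme \<Rightarrow> nat \<Rightarrow> 'a word \<Rightarrow> 'a word \<Rightarrow> bool"
  for B :: "('a, 'm) braid_data_scheme" and n :: nat where
  far: "\<lbrakk>a \<in> labels B; b \<in> labels B; i \<in> {1..<n}; j \<in> {1..<n}; i + 1 < j \<or> j + 1 < i\<rbrakk>
    \<Longrightarrow> move B n [(a, i), (b, j)] [(b, j), (a, i)]"
| R2_pos: "\<lbrakk>a \<in> R2_moves B; i \<in> {1..<n}\<rbrakk> \<Longrightarrow> move B n [(a, i), (neg B a, i)] []"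
| R2_neg: "\<lbrakk>a \<in> R2_moves B; i \<in> {1..<n}\<rbrakk> \<Longrightarrow> move B n [(neg B a, i), (a, i)] []"
| R3: "\<lbrakk>(a, b, c) \<in> R3_moves B; 1 \<le> i; i + 1 < n\<rbrakk>
    \<Longrightarrow> move B n [(a, i), (b, i + 1), (c, i)] [(c, i + 1), (b, i), (a, i + 1)]"
| comm: "\<lbrakk>(a, b) \<in> comm_moves B; i \<in> {1..<n}\<rbrakk>
    \<Longrightarrow> move B n [(a, i), (b, i)] [(b, i), (a, i)]"

inductive braid_equiv :: "('a, 'm) braid_data_scheme \<Rightarrow> nat \<Rightarrow> 'a word \<Rightarrow> 'a word \<Rightarrow> bool"
  for B :: "('a, 'm) braid_data_scheme" and n :: nat where
  refl: "w \<in> diagrams B n \<Longrightarrow> braid_equiv B n w w"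
| sym: "braid_equiv B n u v \<Longrightarrow> braid_equiv B n v u"
| trans: "\<lbrakk>braid_equiv B n u v; braid_equiv B n v w\<rbrakk> \<Longrightarrow> braid_equiv B n u w"
| step: "\<lbrakk>move B n u v; l \<in> diagrams B n; r \<in> diagrams B n\<rbrakk>
    \<Longrightarrow> braid_equiv B n (l @ u @ r) (l @ v @ r)"

definition braid :: "('a, 'm) braid_data_scheme \<Rightarrow> nat \<Rightarrow> 'a word \<Rightarrow> 'a word set" where
  "braid B n w = {v. braid_equiv B n w v}"

definition gB :: "('a, 'm) braid_data_scheme \<Rightarrow> nat \<Rightarrow> 'a word set monoid" where
  "gB B n = \<lparr>carrier = braid B n ` diagrams B n,
             mult = (\<lambda>X Y. \<Union>u\<in>X. \<Union>v\<in>Y. braid B n (u @ v)),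
             one = braid B n []\<rparr>"

locale regular_braid_theory = braid_theory +
  assumes regular: "R2_moves B = tags B"

text \<open>
  The relations of a dominant tag are required to hold in \<open>gB B n\<close>; they need not be among the
  specified third moves, although specifying the third moves \<open>(x, x, a)\<close> and \<open>(a, x, x)\<close> for
  all labels \<open>a\<close> is sufficient (lemma \<open>dominantI\<close>). Hence normality refers to the number of
  strands \<open>n\<close>.
\<close>

definition dominant :: "('a, 'm) braid_data_scheme \<Rightarrow> nat \<Rightarrow> 'a \<Rightarrow> bool" where
  "dominant B n x \<longleftrightarrow> x \<in> tags B \<and>
     (\<forall>a\<in>labels B. \<forall>i. 1 \<le> i \<and> i + 2 \<le> n \<longrightarrow>
        braid B n [(x, i), (x, i + 1), (a, i)] = braid B n [(a, i + 1), (x, i), (x, i + 1)] \<and>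
        braid B n [(x, i + 1), (x, i), (a, i + 1)] = braid B n [(a, i), (x, i + 1), (x, i)])"

locale normal_braid_theory = regular_braid_theory +
  fixes n :: nat
  assumes ex_dominant: "\<exists>x. dominant B n x"

text \<open>
  The word \<open>y\<^bsub>p-1\<^esub> \<dots> y\<^bsub>1\<^esub>\<close>, where \<open>y i\<close> is the label of the crossing at position \<open>i\<close>.
\<close>

definition layer :: "nat \<Rightarrow> (nat \<Rightarrow> 'a) \<Rightarrow> 'a word" where
  "layer p y = map (\<lambda>i. (y i, i)) (rev [1..<p])"

definition quasitoric :: "('a, 'm) braid_data_scheme \<Rightarrow> nat \<Rightarrow> nat \<Rightarrow> 'a word set \<Rightarrow> bool" where
  "quasitoric B p q X \<longleftrightarrow>
     (\<exists>y. (\<forall>j\<in>{1..q}. \<forall>i\<in>{1..<p}. y j i \<in> labels B) \<and>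
          X = braid B p (concat (map (\<lambda>j. layer p (y j)) [1..<q + 1])))"

definition qgB :: "('a, 'm) braid_data_scheme \<Rightarrow> nat \<Rightarrow> 'a word set set" where
  "qgB B n = {X. \<exists>q\<ge>1. quasitoric B n q X}"


lemma diagrams_append [simp]: "u @ v \<in> diagrams B n \<longleftrightarrow> u \<in> diagrams B n \<and> v \<in> diagrams B n"
  by (auto simp: diagrams_def)

lemma diagrams_Nil [simp]: "[] \<in> diagrams B n"
  by (simp add: diagrams_def)

lemma diagrams_Cons [simp]:
  "(a, i) # w \<in> diagrams B n \<longleftrightarrow> a \<in> labels B \<and> 1 \<le> i \<and> i < n \<and> w \<in> diagrams B n"
  by (auto simp: diagrams_def)

lemma braid_equiv_append_left:
  "braid_equiv B n u v \<Longrightarrow> w \<in> diagrams B n \<Longrightarrow> braid_equiv B n (w @ u) (w @ v)"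
proof (induction rule: braid_equiv.induct)
  case (step u v l r)
  then show ?case
    using braid_equiv.step[of B n u v "w @ l" r] by simp
qed (auto intro: braid_equiv.intros)

lemma braid_equiv_append_right:
  "braid_equiv B n u v \<Longrightarrow> w \<in> diagrams B n \<Longrightarrow> braid_equiv B n (u @ w) (v @ w)"
proof (induction rule: braid_equiv.induct)
  case (step u v l r)
  then show ?case
    using braid_equiv.step[of B n u v l "r @ w"] by simp
qed (auto intro: braid_equiv.intros)

lemma braid_eq_iff:
  "u \<in> diagrams B n \<Longrightarrow> braid B n u = braid B n v \<longleftrightarrow> braid_equiv B n u v"
  unfolding braid_def by (blast intro: braid_equiv.intros)

context braid_theory
begin

lemma neg_labels: "a \<in> labels B \<Longrightarrow> neg B a \<in> labels B"
  using neg_neg by (auto simp: labels_def)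

lemma move_diagrams: "move B n u v \<Longrightarrow> u \<in> diagrams B n \<and> v \<in> diagrams B n"
proof (induction rule: move.induct)
  case (R2_pos a i)
  then show ?case using R2_tags by (auto simp: labels_def)
next
  case (R2_neg a i)
  then show ?case using R2_tags by (auto simp: labels_def)
next
  case (R3 a b c i)
  then show ?case using R3_labels by auto
next
  case (comm a b i)
  then show ?case using comm_labels by auto
qed auto

lemma braid_equiv_diagrams:
  "braid_equiv B n u v \<Longrightarrow> u \<in> diagrams B n \<and> v \<in> diagrams B n"
  by (induction rule: braid_equiv.induct) (auto dest: move_diagrams)

lemma braid_equiv_append:
  assumes "braid_equiv B n u u'" "braid_equiv B n v v'"
  shows "braid_equiv B n (u @ v) (u' @ v')"
  using assms braid_equiv_append_left[OF assms(2), of u]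
    braid_equiv_append_right[OF assms(1), of v'] braid_equiv_diagrams
  by (meson braid_equiv.trans)

lemma mult_braid:
  assumes "u \<in> diagrams B n" "v \<in> diagrams B n"
  shows "braid B n u \<otimes>\<^bsub>gB B n\<^esub> braid B n v = braid B n (u @ v)"
  using assms by (auto simp: gB_def braid_def
    intro: braid_equiv.trans[OF braid_equiv_append] braid_equiv.refl)

lemma monoid_gB: "monoid (gB B n)"
proof (rule monoidI)
  fix X Y Z
  assume "X \<in> carrier (gB B n)" "Y \<in> carrier (gB B n)" "Z \<in> carrier (gB B n)"
  then obtain u v w where
    "X = braid B n u" "Y = braid B n v" "Z = braid B n w"
    "u \<in> diagrams B n" "v \<in> diagrams B n" "w \<in> diagrams B n"
    by (auto simp: gB_def)
  then show "X \<otimes>\<^bsub>gB B n\<^esub> Y \<otimes>\<^bsub>gB B n\<^esub> Z = X \<otimes>\<^bsub>gB B n\<^esub> (Y \<otimes>\<^bsub>gB B n\<^esub> Z)"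
    by (simp add: mult_braid)
next
  fix X Y
  assume "X \<in> carrier (gB B n)" "Y \<in> carrier (gB B n)"
  then obtain u v where
    "X = braid B n u" "Y = braid B n v" "u \<in> diagrams B n" "v \<in> diagrams B n"
    by (auto simp: gB_def)
  then show "X \<otimes>\<^bsub>gB B n\<^esub> Y \<in> carrier (gB B n)"
    by (simp add: mult_braid) (simp add: gB_def)
next
  show "\<one>\<^bsub>gB B n\<^esub> \<in> carrier (gB B n)"
    by (simp add: gB_def)
next
  fix X
  assume "X \<in> carrier (gB B n)"
  then obtain u where u: "X = braid B n u" "u \<in> diagrams B n"
    by (auto simp: gB_def)
  have one: "\<one>\<^bsub>gB B n\<^esub> = braid B n []"
    by (simp add: gB_def)
  show "\<one>\<^bsub>gB B n\<^esub> \<otimes>\<^bsub>gB B n\<^esub> X = X" "X \<otimes>\<^bsub>gB B n\<^esub> \<one>\<^bsub>gB B n\<^esub> = X"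
    using u mult_braid[of "[]" n u] mult_braid[of u n "[]"] by (simp_all add: one)
qed

lemma dominantI:
  assumes "x \<in> tags B"
    and "\<And>a. a \<in> labels B \<Longrightarrow> (x, x, a) \<in> R3_moves B \<and> (a, x, x) \<in> R3_moves B"
  shows "dominant B n x"
proof -
  have *: "braid B n [(a, i), (b, i + 1), (c, i)] = braid B n [(c, i + 1), (b, i), (a, i + 1)]"
    if "(a, b, c) \<in> R3_moves B" "1 \<le> i" "i + 2 \<le> n" for a b c i
  proof -
    have m: "move B n [(a, i), (b, i + 1), (c, i)] [(c, i + 1), (b, i), (a, i + 1)]"
      using that by (intro move.R3) auto
    then show ?thesis
      using braid_equiv.step[OF m, of "[]" "[]"] move_diagrams[OF m]
      by (simp add: braid_eq_iff)
  qed
  show ?thesis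
    unfolding dominant_def
  proof (intro conjI ballI allI impI)
    show "x \<in> tags B" by fact
  qed (use assms(2) * in auto)
qed

end

context regular_braid_theory
begin

lemma braid_equiv_neg:
  assumes "a \<in> labels B" "1 \<le> i" "i < n"
  shows "braid_equiv B n [(neg B a, i), (a, i)] []"
proof -
  have "move B n [(neg B a, i), (a, i)] []"
    using assms move.R2_pos[of _ B i n] move.R2_neg[of _ B i n] regular neg_neg
    by (auto simp: labels_def)
  then show ?thesis
    using braid_equiv.step[of B n _ _ "[]" "[]"] by fastforce
qed

lemma left_inverse:
  assumes "w \<in> diagrams B n"
  shows "\<exists>v\<in>diagrams B n. braid_equiv B n (v @ w) []"
  using assms
proof (induction w)
  case Nil
  then show ?case by (intro bexI[of _ "[]"]) (simp_all add: braid_equiv.refl)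
next
  case (Cons c w)
  obtain a i where c: "c = (a, i)" by (cases c)
  with Cons.prems have ai: "a \<in> labels B" "1 \<le> i" "i < n" and w: "w \<in> diagrams B n"
    by auto
  with Cons.IH obtain v where v: "v \<in> diagrams B n" "braid_equiv B n (v @ w) []"
    by auto
  have "braid_equiv B n (v @ [(neg B a, i), (a, i)] @ w) (v @ [] @ w)"
    using v w ai by (intro braid_equiv_append_left braid_equiv_append_right braid_equiv_neg) auto
  then have "braid_equiv B n ((v @ [(neg B a, i)]) @ c # w) []"
    using v(2) c by (auto intro: braid_equiv.trans)
  moreover have "v @ [(neg B a, i)] \<in> diagrams B n"
    using v ai neg_labels by auto
  ultimately show ?case by blast
qed

theorem group_gB: "group (gB B n)"
proof -
  interpret monoid "gB B n" by (rule monoid_gB)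
  show ?thesis
  proof (rule groupI)
    fix X
    assume "X \<in> carrier (gB B n)"
    then obtain w where w: "X = braid B n w" "w \<in> diagrams B n"
      by (auto simp: gB_def)
    then obtain v where v: "v \<in> diagrams B n" "braid_equiv B n (v @ w) []"
      using left_inverse by blast
    have "braid B n v \<otimes>\<^bsub>gB B n\<^esub> X = \<one>\<^bsub>gB B n\<^esub>"
      using v w by (simp add: mult_braid braid_eq_iff) (simp add: gB_def braid_eq_iff)
    moreover have "braid B n v \<in> carrier (gB B n)"
      using v by (simp add: gB_def)
    ultimately show "\<exists>Y\<in>carrier (gB B n). Y \<otimes>\<^bsub>gB B n\<^esub> X = \<one>\<^bsub>gB B n\<^esub>" by blast
  qed (auto simp: m_assoc)
qed

lemma inv_crossing:
  assumes "a \<in> labels B" "1 \<le> i" "i < n"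
  shows "inv\<^bsub>gB B n\<^esub> (braid B n [(a, i)]) = braid B n [(neg B a, i)]"
proof (rule group.inv_equality[OF group_gB])
  show "braid B n [(neg B a, i)] \<otimes>\<^bsub>gB B n\<^esub> braid B n [(a, i)] = \<one>\<^bsub>gB B n\<^esub>"
    using assms neg_labels braid_equiv_neg
    by (simp add: mult_braid braid_eq_iff) (simp add: gB_def braid_eq_iff)
qed (use assms neg_labels in \<open>auto simp: gB_def\<close>)

end

end

theory Submission
  imports Defs
begin

text \<open>
  Only the inverse of a layer $y_{n-1} \cdots y_1$ is in question. Let $x$ be dominant, and put
  $\delta = x_{n-1} \cdots x_1$, $\epsilon = \bar x_{n-1} \cdots \bar x_1$ and
  $P_i = x_{n-1} \cdots x_{i+1}$. In the subgroup generated by the $x_i$, the element $\delta^n$ is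
  central and $\epsilon^{-1}$ is conjugate to $\delta$, so $\delta^n \epsilon^n = 1$; hence
  $1$, $\delta^{-1}$ and $\epsilon^{-1}$ are quasitoric.

  Replacing the label at position $i$ of $\delta$ by $a$ multiplies $\delta$ from the left by
  $t_i(a) = P_i a_i \bar x_i P_i^{-1}$, and $y_{n-1} \cdots y_1 = t_{n-1}(y_{n-1}) \cdots t_1(y_1) \delta$.
  So it suffices that each $t_i(a)^{-1}$ is quasitoric. Since $x$ is dominant,
  $t_i(a)^{-1} = \delta^j P_j \bar a_j x_j P_j^{-1} \delta^{-j}$ with $j = n - i$, and
  $P_j \bar a_j x_j P_j^{-1} = t_j(\bar a) A_j$ with $A_j = P_j x_j^2 P_j^{-1} = t_j(\bar x)^{-1}$.
  Finally $A_1 \cdots A_{n-1} = \delta \epsilon^{-1}$ is quasitoric, as are all $A_k^{-1}$, and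
  cancelling all factors but one shows that each $A_j$ is quasitoric.
\<close>

section \<open>Descending products and conjugation in a group\<close>

context group
begin

lemma inv_cancel:
  assumes "g \<in> carrier G" "h \<in> carrier G"
  shows "g \<otimes> (inv g \<otimes> h) = h" "inv g \<otimes> (g \<otimes> h) = h"
  using assms by (simp_all add: m_assoc[symmetric])

text \<open>The half-open range and the reversed order match \<open>layer\<close>, so that a layer
  is a \<open>desc\<close> from 1 to \<open>n\<close>.\<close>

definition desc :: "(nat \<Rightarrow> 'a) \<Rightarrow> nat \<Rightarrow> nat \<Rightarrow> 'a" where
  "desc f i j = foldr (\<lambda>k. (\<otimes>) (f k)) (rev [i..<j]) \<one>"

lemma foldr_mult_append:
  assumes "\<And>k. f k \<in> carrier G"
  shows "foldr (\<lambda>k. (\<otimes>) (f k)) (u @ v) \<one> =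
    foldr (\<lambda>k. (\<otimes>) (f k)) u \<one> \<otimes> foldr (\<lambda>k. (\<otimes>) (f k)) v \<one>"
proof -
  have *: "foldr (\<lambda>k. (\<otimes>) (f k)) w \<one> \<in> carrier G" for w
    by (induction w) (use assms in auto)
  show ?thesis
    by (induction u) (simp_all add: assms * m_assoc)
qed

lemma desc_closed [simp, intro]:
  assumes "\<And>k. f k \<in> carrier G"
  shows "desc f i j \<in> carrier G"
proof -
  have "foldr (\<lambda>k. (\<otimes>) (f k)) w \<one> \<in> carrier G" for w
    by (induction w) (use assms in auto)
  then show ?thesis by (simp add: desc_def)
qed

lemma desc_empty [simp]: "desc f i i = \<one>"
  by (simp add: desc_def)

lemma desc_Suc: "i \<le> j \<Longrightarrow> desc f i (Suc j) = f j \<otimes> desc f i j"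
  by (simp add: desc_def)

lemma desc_split:
  assumes "\<And>k. f k \<in> carrier G" "i \<le> k" "k \<le> j"
  shows "desc f i j = desc f k j \<otimes> desc f i k"
proof -
  have "[i..<j] = [i..<k] @ [k..<j]"
    using assms(2,3) by (metis upt_add_eq_append le_add_diff_inverse)
  then show ?thesis
    by (simp only: desc_def rev_append foldr_mult_append[OF assms(1)])
qed

lemma desc_rec:
  assumes "\<And>k. f k \<in> carrier G" "i < j"
  shows "desc f i j = desc f (Suc i) j \<otimes> f i"
  using desc_split[of f i "Suc i" j] desc_Suc[of i i f] assms by simp

lemma desc_at:
  assumes "\<And>k. f k \<in> carrier G" "i \<le> k" "k < j"
  shows "desc f i j = desc f (Suc k) j \<otimes> (f k \<otimes> desc f i k)"
  using assms desc_split[of f i "Suc k" j] desc_Suc[of i k f] by simp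

lemma desc_cong:
  assumes "\<And>k. i \<le> k \<Longrightarrow> k < j \<Longrightarrow> f k = f' k"
  shows "desc f i j = desc f' i j"
  unfolding desc_def by (rule foldr_cong) (use assms in auto)

text \<open>This is a = g b g^{-1} without inverses: conjugations then chain along products of
  \<open>g\<close>, and the case a = b is commutation.\<close>

definition intertwines :: "'a \<Rightarrow> 'a \<Rightarrow> 'a \<Rightarrow> bool" where
  "intertwines g a b \<longleftrightarrow> g \<in> carrier G \<and> a \<in> carrier G \<and> b \<in> carrier G \<and> a \<otimes> g = g \<otimes> b"

lemma intertwines_mult:
  assumes "intertwines g a b" "intertwines h b c"
  shows "intertwines (g \<otimes> h) a c"
proof -
  have [simp]: "g \<in> carrier G" "h \<in> carrier G" "a \<in> carrier G" "b \<in> carrier G" "c \<in> carrier G"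
    and eq: "a \<otimes> g = g \<otimes> b" "b \<otimes> h = h \<otimes> c"
    using assms by (auto simp: intertwines_def)
  have "a \<otimes> (g \<otimes> h) = g \<otimes> (b \<otimes> h)"
    by (simp add: m_assoc[symmetric] eq(1))
  then show ?thesis
    by (simp add: intertwines_def m_assoc eq(2))
qed

lemma intertwines_mult_right:
  assumes "intertwines g a b" "intertwines g c d"
  shows "intertwines g (a \<otimes> c) (b \<otimes> d)"
proof -
  have [simp]: "g \<in> carrier G" "a \<in> carrier G" "b \<in> carrier G" "c \<in> carrier G" "d \<in> carrier G"
    and eq: "a \<otimes> g = g \<otimes> b" "c \<otimes> g = g \<otimes> d"
    using assms by (auto simp: intertwines_def)
  have "a \<otimes> c \<otimes> g = a \<otimes> (g \<otimes> d)"
    by (simp add: m_assoc eq(2))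
  then show ?thesis
    by (simp add: intertwines_def m_assoc[symmetric] eq(1))
qed

lemma intertwines_one [simp]: "g \<in> carrier G \<Longrightarrow> intertwines g \<one> \<one>"
  by (simp add: intertwines_def)

lemma one_intertwines [simp]: "a \<in> carrier G \<Longrightarrow> intertwines \<one> a a"
  by (simp add: intertwines_def)

lemma intertwines_conj:
  assumes "g \<in> carrier G" "b \<in> carrier G"
  shows "intertwines g (g \<otimes> b \<otimes> inv g) b"
  using assms by (simp add: intertwines_def m_assoc)

lemma intertwines_unique:
  assumes "intertwines g a b" "intertwines g a' b"
  shows "a = a'"
  using assms unfolding intertwines_def by (metis right_cancel)

lemma intertwines_cancel:
  assumes "intertwines (g \<otimes> h) a c" "intertwines h b c" "g \<in> carrier G"
  shows "intertwines g a b"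
proof -
  have "intertwines g (g \<otimes> b \<otimes> inv g) b"
    using assms by (intro intertwines_conj) (auto simp: intertwines_def)
  moreover from this have "g \<otimes> b \<otimes> inv g = a"
    using assms(1,2) intertwines_mult intertwines_unique by metis
  ultimately show ?thesis by simp
qed

lemma intertwines_commute:
  "intertwines g a a \<longleftrightarrow> intertwines a g g"
  by (auto simp: intertwines_def)

lemma intertwines_pow:
  assumes "intertwines g a b"
  shows "intertwines g (a [^] (k::nat)) (b [^] k)"
proof (induction k)
  case 0
  then show ?case using assms by (simp add: intertwines_def)
next
  case (Suc k)
  then show ?case using assms by (simp add: intertwines_mult_right)
qed

lemma intertwines_desc:
  assumes "\<And>k. f k \<in> carrier G" "\<And>k. f' k \<in> carrier G" "g \<in> carrier G"
    and "\<And>k. i \<le> k \<Longrightarrow> k < j \<Longrightarrow> intertwines g (f k) (f' (k + m))"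
  shows "intertwines g (desc f i j) (desc f' (i + m) (j + m))"
proof (cases "i \<le> j")
  case True
  then show ?thesis
    using assms(4)
  proof (induction j rule: dec_induct)
    case base
    then show ?case using assms by simp
  next
    case (step j)
    then show ?case
      by (simp add: desc_Suc intertwines_mult_right)
  qed
next
  case False
  then show ?thesis using assms by (simp add: desc_def)
qed

lemma desc_commute:
  assumes "\<And>k. f k \<in> carrier G" "g \<in> carrier G"
    and "\<And>k. i \<le> k \<Longrightarrow> k < j \<Longrightarrow> intertwines g (f k) (f k)"
  shows "intertwines (desc f i j) g g"
  using intertwines_desc[of f f g i j 0] assms intertwines_commute by simp

end

text \<open>The elements of \<open>A\<close> are the sequences $a_1, a_2, \ldots$, one for each label $a$, and \<open>Q\<close> stands
  for the set of quasitoric braids. Values outside \<open>{1..<n}\<close> are irrelevant, but must satisfy the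
  unguarded conditions; \<open>crossing\<close> below sets them to the identity.\<close>

locale dominant_generators = group G for G (structure) +
  fixes n :: nat and A :: "(nat \<Rightarrow> 'a) set" and x :: "nat \<Rightarrow> 'a" and Q :: "'a set"
  assumes n_ge: "2 \<le> n"
    and A_closed: "a \<in> A \<Longrightarrow> a i \<in> carrier G"
    and A_inv: "a \<in> A \<Longrightarrow> (\<lambda>i. inv (a i)) \<in> A"
    and far: "\<lbrakk>a \<in> A; b \<in> A; i + 1 < j\<rbrakk> \<Longrightarrow> intertwines (a i) (b j) (b j)"
    and x_in: "x \<in> A"
    and dom_up: "\<lbrakk>a \<in> A; 1 \<le> i; i + 1 < n\<rbrakk>
      \<Longrightarrow> intertwines (x i \<otimes> x (Suc i)) (a (Suc i)) (a i)"
    and dom_down: "\<lbrakk>a \<in> A; 1 \<le> i; i + 1 < n\<rbrakk>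
      \<Longrightarrow> intertwines (x (Suc i) \<otimes> x i) (a i) (a (Suc i))"
    and Q_sub: "Q \<subseteq> carrier G"
    and Q_mult: "\<lbrakk>u \<in> Q; v \<in> Q\<rbrakk> \<Longrightarrow> u \<otimes> v \<in> Q"
    and Q_desc: "\<lbrakk>\<And>i. 1 \<le> i \<Longrightarrow> i < n \<Longrightarrow> \<exists>a\<in>A. y i = a i\<rbrakk> \<Longrightarrow> desc y 1 n \<in> Q"
begin

section \<open>Shifting by \<delta> and the central power \<delta>^n\<close>

abbreviation "\<delta> \<equiv> desc x 1 n"
abbreviation "x' \<equiv> \<lambda>i. inv (x i)"
abbreviation "\<epsilon> \<equiv> desc x' 1 n"

lemma x_closed [simp]: "x i \<in> carrier G"
  using A_closed x_in by blast

lemma x'_in: "x' \<in> A"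
  using A_inv x_in by blast

lemma far': "\<lbrakk>a \<in> A; b \<in> A; i + 1 < j \<or> j + 1 < i\<rbrakk> \<Longrightarrow> intertwines (a i) (b j) (b j)"
  using far[of a b i j] far[of b a j i] intertwines_commute by auto

lemma desc_far:
  assumes "f \<in> A" "a \<in> A" "\<And>k. i \<le> k \<Longrightarrow> k < j \<Longrightarrow> k + 1 < l \<or> l + 1 < k"
  shows "intertwines (desc f i j) (a l) (a l)"
  by (rule desc_commute) (use assms A_closed far'[OF assms(1,2)] in \<open>auto simp: intertwines_commute\<close>)

text \<open>Factors of \<delta> above position i + 1 are far from i, and those below i are far from
  i + 1. Only the middle pair x_{i+1} x_i acts, through \<open>dom_down\<close>.\<close>

lemma delta_shift:
  assumes "a \<in> A" "1 \<le> i" "i + 1 < n"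
  shows "intertwines \<delta> (a i) (a (Suc i))"
proof -
  have "\<delta> = desc x (Suc (Suc i)) n \<otimes> ((x (Suc i) \<otimes> x i) \<otimes> desc x 1 i)"
    using assms desc_at[of x 1 "Suc i" n] desc_Suc[of 1 i x] by (simp add: m_assoc)
  moreover have "intertwines (desc x (Suc (Suc i)) n) (a i) (a i)"
    using assms by (intro desc_far[OF x_in assms(1)]) auto
  moreover have "intertwines (desc x 1 i) (a (Suc i)) (a (Suc i))"
    using assms by (intro desc_far[OF x_in assms(1)]) auto
  ultimately show ?thesis
    using dom_down[OF assms] intertwines_mult by presburger
qed

lemma delta_pow_shift:
  assumes "a \<in> A" "1 \<le> i" "i + m < n"
  shows "intertwines (\<delta> [^] m) (a i) (a (i + m))"
  using assms(3)
proof (induction m)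
  case 0
  then show ?case using assms A_closed by simp
next
  case (Suc m)
  then show ?case
    using assms intertwines_mult[of "\<delta> [^] m" "a i" "a (i + m)"] delta_shift[of a "i + m"] by simp
qed

text \<open>The shift stops at the last position; two passes of \<delta> wrap round to 1. Shifting
  \<open>?\<rho>\<close> past \<delta> gives \<delta>^2 = \<open>?\<rho>\<close> \<delta> x_1, and
  x_{n-1} on the left completes \<open>?\<rho>\<close> to \<delta>.\<close>

lemma delta_wrap: "intertwines (\<delta> [^] (2::nat)) (x (n - 1)) (x 1)"
proof -
  let ?\<rho> = "desc x 1 (n - 1)"
  have 1: "\<delta> = desc x 2 n \<otimes> x 1"
    using n_ge desc_rec[of x 1 n] by (simp add: numeral_2_eq_2)
  have 2: "\<delta> = x (n - 1) \<otimes> ?\<rho>"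
    using n_ge desc_Suc[of 1 "n - 1" x] by simp
  have "intertwines \<delta> (desc x 1 (n - 1)) (desc x (1 + 1) (n - 1 + 1))"
    using delta_shift[OF x_in] by (intro intertwines_desc) auto
  then have 3: "?\<rho> \<otimes> \<delta> = \<delta> \<otimes> desc x 2 n"
    using n_ge by (simp add: intertwines_def numeral_2_eq_2)
  have "\<delta> \<otimes> \<delta> = \<delta> \<otimes> desc x 2 n \<otimes> x 1"
    using 1 by (metis desc_closed m_assoc x_closed)
  then have 4: "\<delta> \<otimes> \<delta> = ?\<rho> \<otimes> \<delta> \<otimes> x 1"
    using 3 by simp
  have "x (n - 1) \<otimes> (\<delta> \<otimes> \<delta>) = (x (n - 1) \<otimes> ?\<rho>) \<otimes> \<delta> \<otimes> x 1"
    unfolding 4 by (simp add: m_assoc)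
  also have "\<dots> = \<delta> \<otimes> \<delta> \<otimes> x 1"
    using 2 by simp
  finally show ?thesis
    by (simp add: intertwines_def numeral_2_eq_2)
qed

text \<open>The index i moves up to n - 1, wraps to 1 and moves up to i again, which takes (n - 1 -
  i) + 2 + (i - 1) = n factors \<delta>.\<close>

lemma delta_pow_n_central:
  assumes "1 \<le> i" "i < n"
  shows "intertwines (\<delta> [^] n) (x i) (x i)"
proof -
  have "intertwines (\<delta> [^] (n - 1 - i)) (x i) (x (n - 1))"
    using delta_pow_shift[of x i "n - 1 - i"] assms x_in by simp
  moreover have "intertwines (\<delta> [^] (i - 1)) (x 1) (x i)"
    using delta_pow_shift[of x 1 "i - 1"] assms x_in by simp
  ultimately have
    "intertwines (\<delta> [^] (n - 1 - i) \<otimes> (\<delta> [^] (2::nat) \<otimes> \<delta> [^] (i - 1))) (x i) (x i)"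
    using delta_wrap intertwines_mult by blast
  moreover have "\<delta> [^] (n - 1 - i) \<otimes> (\<delta> [^] (2::nat) \<otimes> \<delta> [^] (i - 1)) =
      \<delta> [^] (n - 1 - i + (2 + (i - 1)))"
    by (simp only: nat_pow_mult desc_closed x_closed)
  moreover have "n - 1 - i + (2 + (i - 1)) = n"
    using assms by simp
  ultimately show ?thesis
    by simp
qed

text \<open>\<open>inv (desc x' i j)\<close> is the ascending product x_i ... x_{j-1}, so
  \<open>desc\<close> covers both orders.\<close>

lemma inv_desc_x'_Suc:
  "i \<le> j \<Longrightarrow> inv (desc x' i (Suc j)) = inv (desc x' i j) \<otimes> x j"
  by (simp add: desc_Suc inv_mult_group)

text \<open>All the words $x_1 \cdots x_{k-1} x_{n-1} \cdots x_k$ are conjugate under the $x_i$.\<close>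

lemma coxeter_pow:
  assumes "1 \<le> k" "k \<le> n"
  shows "(inv (desc x' 1 k) \<otimes> desc x k n) [^] n = \<delta> [^] n"
  using assms
proof (induction k rule: dec_induct)
  case base
  then show ?case by simp
next
  case (step k)
  let ?u = "inv (desc x' 1 k)" and ?v = "desc x (Suc k) n"
  let ?w = "?u \<otimes> desc x k n" and ?w' = "inv (desc x' 1 (Suc k)) \<otimes> ?v"
  \<comment> \<open>Positions below k are far from positions above k, so the two words
    commute.\<close>
  have "intertwines (desc x' 1 k) ?v ?v"
  proof (rule desc_commute)
    fix l assume "1 \<le> l" "l < k"
    then show "intertwines ?v (x' l) (x' l)"
      using x_in desc_far[OF x_in x'_in] by auto
  qed auto
  then have uv: "?u \<otimes> ?v = ?v \<otimes> ?u"
    unfolding intertwines_def by (metis inv_closed inv_solve_left' inv_solve_right' m_assoc m_closed)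
  have w: "?w = ?u \<otimes> ?v \<otimes> x k"
    using step desc_rec[of x k n] by (simp add: m_assoc)
  have w': "?w' = ?u \<otimes> x k \<otimes> ?v"
    using step by (simp add: inv_desc_x'_Suc)
  \<comment> \<open>Moving \<open>?v\<close> from the front of \<open>?v ?u x_k\<close> to its end
    is a conjugation by \<open>?v\<close>; it fixes the n-th power because \<delta>^n commutes with
    every x_i.\<close>
  have "intertwines ?v ?w ?w'"
    unfolding w w' uv by (simp add: intertwines_def m_assoc)
  then have "intertwines ?v (?w [^] n) (?w' [^] n)"
    by (rule intertwines_pow)
  moreover have "?w [^] n = \<delta> [^] n"
    using step by simp
  moreover have "intertwines ?v (\<delta> [^] n) (\<delta> [^] n)"
    using delta_pow_n_central by (intro desc_commute) auto
  ultimately show ?case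
    unfolding intertwines_def by (metis Units_eq Units_l_cancel)
qed

text \<open>At k = n the conjugate word is the ascending product \<epsilon>^{-1}, so \<epsilon>^{-1}
  and \<delta> have the same n-th power.\<close>

lemma delta_epsilon_pow: "\<delta> [^] n \<otimes> \<epsilon> [^] n = \<one>"
proof -
  have "\<delta> [^] n = inv (\<epsilon> [^] n)"
    using coxeter_pow[of n] n_ge by (simp add: nat_pow_inv)
  then show ?thesis by simp
qed

section \<open>The identity, \<delta>^{-1} and \<epsilon>^{-1} as quasitoric elements\<close>

lemma Q_closed [simp]: "u \<in> Q \<Longrightarrow> u \<in> carrier G"
  using Q_sub by blast

lemma delta_in: "\<delta> \<in> Q"
  using x_in by (intro Q_desc) auto

lemma epsilon_in: "\<epsilon> \<in> Q"
  using x'_in by (intro Q_desc) auto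

lemma Q_pow:
  assumes "u \<in> Q" "0 < k"
  shows "u [^] (k::nat) \<in> Q"
  using assms(2) by (induction k rule: nat_induct_non_zero) (use assms Q_mult in auto)

text \<open>A quasitoric word has at least one layer, so the empty word does not qualify; n layers
  \<delta> and n layers \<epsilon> represent the identity instead.\<close>

lemma one_in: "\<one> \<in> Q"
  using delta_epsilon_pow Q_mult[OF Q_pow[OF delta_in] Q_pow[OF epsilon_in], of n n] n_ge by simp

lemma Q_pow': "u \<in> Q \<Longrightarrow> u [^] (k::nat) \<in> Q"
  using Q_pow[of u k] one_in by (cases k) auto

lemma inv_delta_in: "inv \<delta> \<in> Q"
proof -
  have "\<delta> \<otimes> (\<delta> [^] (n - 1) \<otimes> \<epsilon> [^] n) = (\<delta> [^] Suc (n - 1)) \<otimes> \<epsilon> [^] n"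
    using nat_pow_Suc2[of \<delta> "n - 1"] by (simp add: m_assoc[symmetric])
  also have "\<dots> = \<one>"
    using delta_epsilon_pow n_ge by simp
  finally have "inv \<delta> \<otimes> (\<delta> \<otimes> (\<delta> [^] (n - 1) \<otimes> \<epsilon> [^] n)) = inv \<delta>"
    by simp
  then have "inv \<delta> = \<delta> [^] (n - 1) \<otimes> \<epsilon> [^] n"
    by (simp add: inv_cancel)
  then show ?thesis
    using Q_mult Q_pow' delta_in epsilon_in by simp
qed

lemma inv_epsilon_in: "inv \<epsilon> \<in> Q"
proof -
  have "\<delta> [^] n \<otimes> \<epsilon> [^] (n - 1) \<otimes> \<epsilon> = \<delta> [^] n \<otimes> \<epsilon> [^] Suc (n - 1)"
    by (simp add: m_assoc)
  also have "\<dots> = \<one>"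
    using delta_epsilon_pow n_ge by simp
  finally have "inv \<epsilon> = \<delta> [^] n \<otimes> \<epsilon> [^] (n - 1)"
    by (intro inv_equality) auto
  then show ?thesis
    using Q_mult Q_pow' delta_in epsilon_in by simp
qed

section \<open>Changing a single label of \<delta>\<close>

abbreviation "P i \<equiv> desc x (Suc i) n"

text \<open>Two layers that differ only at position i have equal tails below i, which cancel in
  their quotient.\<close>

lemma change_in:
  assumes "a \<in> A" "1 \<le> i" "i < n"
  shows "P i \<otimes> (a i \<otimes> x' i) \<otimes> inv (P i) \<in> Q"
proof -
  define y where "y = x(i := a i)"
  have y: "y k \<in> carrier G" "y i = a i" "k \<noteq> i \<Longrightarrow> y k = x k" for k
    using assms A_closed by (auto simp: y_def)
  have "desc y 1 n = desc y (Suc i) n \<otimes> (y i \<otimes> desc y 1 i)"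
    using assms y by (intro desc_at) auto
  also have "desc y (Suc i) n = P i"
    by (rule desc_cong) (auto simp: y)
  also have "desc y 1 i = desc x 1 i"
    by (rule desc_cong) (auto simp: y)
  finally have 1: "desc y 1 n = P i \<otimes> (a i \<otimes> desc x 1 i)"
    by (simp add: y)
  have 2: "\<delta> = P i \<otimes> (x i \<otimes> desc x 1 i)"
    using assms by (intro desc_at) auto
  have "desc y 1 n \<otimes> inv \<delta> = P i \<otimes> (a i \<otimes> x' i) \<otimes> inv (P i)"
    unfolding 1 2 using assms A_closed by (simp add: inv_mult_group m_assoc inv_cancel)
  moreover have "desc y 1 n \<in> Q"
    using assms x_in by (intro Q_desc) (auto simp: y_def)
  ultimately show ?thesis
    using Q_mult inv_delta_in by metis
qed

text \<open>Iteration telescopes a quotient of two layers into conjugated one-letter changes. It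
  serves both for \<open>x'\<close> and for an arbitrary layer.\<close>

lemma quotient_step:
  assumes "\<And>k. y k \<in> carrier G" "k < n"
  shows "desc x k n \<otimes> inv (desc y k n) =
    (P k \<otimes> (x k \<otimes> inv (y k)) \<otimes> inv (P k)) \<otimes> (P k \<otimes> inv (desc y (Suc k) n))"
  using assms desc_rec[of x k n] desc_rec[of y k n]
  by (simp add: inv_mult_group m_assoc inv_cancel)

lemma full_twist_in:
  assumes "1 \<le> k" "k < n"
  shows "P k \<otimes> (x k \<otimes> x k) \<otimes> inv (P k) \<in> Q"
proof -
  \<comment> \<open>\<open>F k\<close> is A_k and \<open>E k\<close> is the tail product A_k ...
    A_{n-1}; thus \<open>E 1\<close> is \<delta> \<epsilon>^{-1} and \<open>E n\<close> is the
    identity.\<close>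
  define E where "E k = desc x k n \<otimes> inv (desc x' k n)" for k
  define F where "F k = P k \<otimes> (x k \<otimes> x k) \<otimes> inv (P k)" for k
  have closed [simp]: "E k \<in> carrier G" "F k \<in> carrier G" for k
    by (simp_all add: E_def F_def)
  have E: "E k = F k \<otimes> E (Suc k)" if "k < n" for k
    using that quotient_step[of x' k] by (simp add: E_def F_def)
  have inv_F: "inv (F k) \<in> Q" if "1 \<le> k" "k < n" for k
    using that change_in[OF x'_in, of k] by (simp add: F_def inv_mult_group m_assoc)
  \<comment> \<open>Stripping A_1, ..., A_{k-1} from the left of \<open>E 1\<close> takes only
    inverses of the A_i, which are changes of x_i to its inverse.\<close>
  have "E k \<in> Q" if "1 \<le> k" "k \<le> n" for k
    using that
  proof (induction k rule: dec_induct)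
    case base
    then show ?case
      using Q_mult delta_in inv_epsilon_in by (simp add: E_def)
  next
    case (step k)
    then have "E (Suc k) = inv (F k) \<otimes> E k"
      by (simp add: E m_assoc[symmetric])
    then show ?case
      using step inv_F Q_mult by simp
  qed
  moreover have "inv (E k) \<in> Q" if "1 \<le> k" "k \<le> n" for k
    using that(2,1)
  proof (induction k rule: inc_induct)
    case base
    then show ?case by (simp add: E_def one_in)
  next
    case (step k)
    then show ?case
      using inv_F Q_mult by (simp add: E inv_mult_group)
  qed
  moreover have "F k = E k \<otimes> inv (E (Suc k))"
    using assms by (simp add: E m_assoc)
  ultimately show ?thesis
    using assms Q_mult by (simp add: F_def)
qed

text \<open>The word regroups as (x_{i-1} x_i) (x_{i-2} x_{i-1}) ... (x_1 x_2), and
  \<open>dom_up\<close> lowers the index by one at each pair.\<close>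

lemma up_down:
  assumes "a \<in> A" "1 \<le> i" "i < n"
  shows "intertwines (desc x 1 i \<otimes> desc x 2 (Suc i)) (a i) (a 1)"
  using assms(2,3)
proof (induction i rule: dec_induct)
  case base
  then show ?case using assms A_closed by (simp add: numeral_2_eq_2)
next
  case (step i)
  have "intertwines (desc x 1 i) (x (Suc i)) (x (Suc i))"
    by (rule desc_far[OF x_in x_in]) auto
  then have "desc x 1 (Suc i) \<otimes> desc x 2 (Suc (Suc i)) =
      (x i \<otimes> x (Suc i)) \<otimes> (desc x 1 i \<otimes> desc x 2 (Suc i))"
    using step by (simp add: desc_Suc m_assoc intertwines_def)
      (metis desc_closed m_assoc x_closed)
  then show ?case
    using step intertwines_mult[OF dom_up] assms by simp
qed

text \<open>The two strands that meet at position $i$ of one layer meet again, in the opposite order,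
  at position $n - i$ of a later layer. Hence the change of the label at position $i$ can be undone
  there.\<close>

lemma inv_change_in:
  assumes "a \<in> A" "1 \<le> i" "i < n"
  shows "P i \<otimes> (x i \<otimes> inv (a i)) \<otimes> inv (P i) \<in> Q"
proof -
  define b where "b = (\<lambda>i. inv (a i))"
  define j where "j = n - i"
  define m where "m = n - Suc i"
  have b: "b \<in> A" and [simp]: "b k \<in> carrier G" for k
    using assms A_inv A_closed by (auto simp: b_def)
  have jm: "j = Suc m" "1 \<le> j" "j < n" "1 + m = j" "2 + m = Suc j" "Suc i + m = n" "1 + m < n"
    using assms by (auto simp: j_def m_def)
  let ?t = "P i \<otimes> (x i \<otimes> b i) \<otimes> inv (P i)"
  let ?s = "P j \<otimes> (b j \<otimes> x j) \<otimes> inv (P j)"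
  let ?S = "desc x 2 (Suc i)"
  \<comment> \<open>The extra factor x_i rotates x_i b_i to b_i x_i and later completes the word to
    \<delta>.\<close>
  have "intertwines (P i \<otimes> x i) ?t (b i \<otimes> x i)"
    by (simp add: intertwines_def m_assoc inv_cancel)
  moreover have "intertwines (desc x 1 i \<otimes> ?S) (b i \<otimes> x i) (b 1 \<otimes> x 1)"
    using assms by (intro intertwines_mult_right up_down[OF b] up_down[OF x_in]) auto
  moreover have "intertwines (\<delta> [^] m) (b 1 \<otimes> x 1) (b j \<otimes> x j)"
    using delta_pow_shift[OF b, of 1 m] delta_pow_shift[OF x_in, of 1 m] jm
    by (intro intertwines_mult_right) auto
  ultimately have "intertwines (P i \<otimes> x i \<otimes> (desc x 1 i \<otimes> ?S) \<otimes> \<delta> [^] m) ?t (b j \<otimes> x j)"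
    using intertwines_mult by blast
  also have "P i \<otimes> x i \<otimes> (desc x 1 i \<otimes> ?S) = \<delta> \<otimes> ?S"
    using assms desc_at[of x 1 i n] by (simp add: m_assoc)
  \<comment> \<open>Shifted by m, the positions 2, ..., i become j + 1, ..., n - 1, so
    \<open>?S\<close> turns into the \<open>P j\<close> that occurs in \<open>?s\<close>.\<close>
  also have "\<delta> \<otimes> ?S \<otimes> \<delta> [^] m = \<delta> \<otimes> \<delta> [^] m \<otimes> P j"
  proof -
    have "intertwines (\<delta> [^] m) ?S (desc x (2 + m) (Suc i + m))"
      using jm by (intro intertwines_desc delta_pow_shift[OF x_in]) auto
    then have "?S \<otimes> \<delta> [^] m = \<delta> [^] m \<otimes> P j"
      using jm by (simp add: intertwines_def)
    then show ?thesis
      by (simp add: m_assoc)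
  qed
  finally have "intertwines (\<delta> \<otimes> \<delta> [^] m \<otimes> P j) ?t (b j \<otimes> x j)" .
  moreover have "intertwines (P j) ?s (b j \<otimes> x j)"
    by (intro intertwines_conj) auto
  ultimately have "intertwines (\<delta> \<otimes> \<delta> [^] m) ?t ?s"
    by (rule intertwines_cancel) auto
  then have "?t = (\<delta> \<otimes> \<delta> [^] m) \<otimes> ?s \<otimes> inv (\<delta> \<otimes> \<delta> [^] m)"
    using intertwines_unique intertwines_conj unfolding intertwines_def by blast
  also have "\<dots> = \<delta> \<otimes> \<delta> [^] m \<otimes> ?s \<otimes> (inv \<delta> [^] m \<otimes> inv \<delta>)"
    by (simp add: inv_mult_group nat_pow_inv)
  finally have t: "?t = \<delta> \<otimes> \<delta> [^] m \<otimes> ?s \<otimes> (inv \<delta> [^] m \<otimes> inv \<delta>)" .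
  have "?s = (P j \<otimes> (b j \<otimes> x' j) \<otimes> inv (P j)) \<otimes> (P j \<otimes> (x j \<otimes> x j) \<otimes> inv (P j))"
    by (simp add: m_assoc inv_cancel)
  then have "?s \<in> Q"
    using change_in[OF b] full_twist_in jm Q_mult by simp
  then have "?t \<in> Q"
    unfolding t using Q_mult Q_pow' delta_in inv_delta_in by simp
  then show ?thesis
    by (simp add: b_def)
qed

text \<open>The quotient of \<delta> by the layer telescopes into inverse one-letter changes, all in
  \<open>Q\<close>; a factor \<delta>^{-1} on the left leaves the inverse of the layer.\<close>

lemma inv_layer_in:
  assumes "\<And>i. 1 \<le> i \<Longrightarrow> i < n \<Longrightarrow> \<exists>a\<in>A. y i = a i"
  shows "inv (desc y 1 n) \<in> Q"
proof -
  \<comment> \<open>\<open>desc_closed\<close> has no range guard, so \<open>y\<close> is set to the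
    identity outside 1, ..., n - 1.\<close>
  define z where "z i = (if 1 \<le> i \<and> i < n then y i else \<one>)" for i
  have z: "\<exists>a\<in>A. z i = a i" if "1 \<le> i" "i < n" for i
    using that assms by (simp add: z_def)
  have [simp]: "z i \<in> carrier G" for i
    using z[of i] A_closed by (auto simp: z_def)
  have "desc x k n \<otimes> inv (desc z k n) \<in> Q" if "1 \<le> k" "k \<le> n" for k
    using that(2,1)
  proof (induction k rule: inc_induct)
    case base
    then show ?case by (simp add: one_in)
  next
    case (step k)
    obtain a where a: "a \<in> A" "z k = a k"
      using z[of k] step by auto
    then have "P k \<otimes> (x k \<otimes> inv (z k)) \<otimes> inv (P k) \<in> Q"
      using inv_change_in[of a k] step by simp
    then show ?case
      using step quotient_step[of z k] Q_mult by simp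
  qed
  then have "inv \<delta> \<otimes> (\<delta> \<otimes> inv (desc z 1 n)) \<in> Q"
    using n_ge Q_mult inv_delta_in by simp
  moreover have "desc z 1 n = desc y 1 n"
    by (rule desc_cong) (simp add: z_def)
  ultimately show ?thesis
    by (simp add: m_assoc[symmetric])
qed

end

section \<open>Transfer to the braid group\<close>

context normal_braid_theory
begin

sublocale group "gB B n"
  by (rule group_gB)

definition crossing :: "'a \<Rightarrow> nat \<Rightarrow> 'a word set" where
  "crossing a i = (if 1 \<le> i \<and> i < n then braid B n [(a, i)] else \<one>\<^bsub>gB B n\<^esub>)"

lemma braid_closed: "w \<in> diagrams B n \<Longrightarrow> braid B n w \<in> carrier (gB B n)"
  by (simp add: gB_def)

lemma braid_Nil: "braid B n [] = \<one>\<^bsub>gB B n\<^esub>"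
  by (simp add: gB_def)

lemma braid_Cons:
  assumes "(a, i) # w \<in> diagrams B n"
  shows "braid B n ((a, i) # w) = crossing a i \<otimes>\<^bsub>gB B n\<^esub> braid B n w"
  using assms mult_braid[of "[(a, i)]" n w] by (simp add: crossing_def)

lemma crossing_closed: "a \<in> labels B \<Longrightarrow> crossing a i \<in> carrier (gB B n)"
  by (simp add: crossing_def braid_closed)

lemma crossing_neg: "a \<in> labels B \<Longrightarrow> crossing (neg B a) i = inv\<^bsub>gB B n\<^esub> (crossing a i)"
  by (simp add: crossing_def inv_crossing)

lemma crossing_far:
  assumes "a \<in> labels B" "b \<in> labels B" "i + 1 < j"
  shows "crossing a i \<otimes>\<^bsub>gB B n\<^esub> crossing b j = crossing b j \<otimes>\<^bsub>gB B n\<^esub> crossing a i"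
proof (cases "1 \<le> i \<and> j < n")
  case True
  then have "move B n [(a, i), (b, j)] [(b, j), (a, i)]"
    using assms by (intro move.far) auto
  then have "braid_equiv B n [(a, i), (b, j)] [(b, j), (a, i)]"
    using braid_equiv.step[of B n _ _ "[]" "[]"] by fastforce
  then have "braid B n [(a, i), (b, j)] = braid B n [(b, j), (a, i)]"
    using True assms by (simp add: braid_eq_iff)
  then show ?thesis
    using True assms crossing_closed by (simp add: braid_Cons braid_Nil)
next
  case False
  then have "crossing a i = \<one>\<^bsub>gB B n\<^esub> \<or> crossing b j = \<one>\<^bsub>gB B n\<^esub>"
    by (auto simp: crossing_def)
  then show ?thesis
    using assms crossing_closed by auto
qed

lemma braid_layer:
  assumes "\<And>i. 1 \<le> i \<Longrightarrow> i < n \<Longrightarrow> y i \<in> labels B"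
  shows "layer n y \<in> diagrams B n"
    and "braid B n (layer n y) = desc (\<lambda>i. crossing (y i) i) 1 n"
proof -
  have "map (\<lambda>i. (y i, i)) is \<in> diagrams B n \<and>
      braid B n (map (\<lambda>i. (y i, i)) is) = foldr (\<lambda>i. (\<otimes>\<^bsub>gB B n\<^esub>) (crossing (y i) i)) is \<one>\<^bsub>gB B n\<^esub>"
    if "set is \<subseteq> {1..<n}" for "is"
    using that by (induction "is") (auto simp: assms braid_Cons braid_Nil)
  from this[of "rev [1..<n]"]
  show "layer n y \<in> diagrams B n"
    and "braid B n (layer n y) = desc (\<lambda>i. crossing (y i) i) 1 n"
    by (simp_all add: layer_def desc_def)
qed

definition layer_labels :: "(nat \<Rightarrow> 'a) set" where
  "layer_labels = {y. \<forall>i\<in>{1..<n}. y i \<in> labels B}"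

lemma layers_diagrams:
  "set ys \<subseteq> layer_labels \<Longrightarrow> concat (map (layer n) ys) \<in> diagrams B n"
  by (induction ys) (auto simp: layer_labels_def braid_layer(1))

text \<open>With the layers in a list instead of a family indexed by 1, ..., q, products become list
  concatenation and inverses follow by list induction.\<close>

lemma qgB_eq:
  "qgB B n = {braid B n (concat (map (layer n) ys)) | ys. ys \<noteq> [] \<and> set ys \<subseteq> layer_labels}"
  (is "_ = ?R")
proof (intro equalityI subsetI)
  fix X assume "X \<in> qgB B n"
  then obtain q y where "q \<ge> 1" "\<forall>j\<in>{1..q}. \<forall>i\<in>{1..<n}. y j i \<in> labels B"
    "X = braid B n (concat (map (layer n) (map y [1..<q + 1])))"
    by (auto simp: qgB_def quasitoric_def comp_def)
  then show "X \<in> ?R"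
    by (intro CollectI exI[of _ "map y [1..<q + 1]"]) (auto simp: layer_labels_def)
next
  fix X assume "X \<in> ?R"
  then obtain ys where ys: "ys \<noteq> []" "set ys \<subseteq> layer_labels"
    "X = braid B n (concat (map (layer n) ys))"
    by auto
  \<comment> \<open>Layers are numbered from 1, list entries from 0.\<close>
  let ?y = "\<lambda>j. ys ! (j - 1)"
  have "map (\<lambda>j. layer n (?y j)) [1..<length ys + 1] = map (layer n) ys"
    by (rule nth_equalityI) (simp_all del: upt_Suc)
  moreover have "?y j \<in> layer_labels" if "j \<in> {1..length ys}" for j
    using that ys(2) by (auto intro!: subsetD[OF ys(2)] nth_mem)
  ultimately have "quasitoric B n (length ys) X"
    unfolding quasitoric_def using ys(3)
    by (intro exI[of _ ?y]) (auto simp: layer_labels_def simp del: upt_Suc)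
  then show "X \<in> qgB B n"
    using ys(1) by (auto simp: qgB_def Suc_le_eq)
qed

lemma qgB_mult:
  assumes "X \<in> qgB B n" "Y \<in> qgB B n"
  shows "X \<otimes>\<^bsub>gB B n\<^esub> Y \<in> qgB B n"
proof -
  obtain ys zs where "ys \<noteq> []" "set ys \<subseteq> layer_labels" "set zs \<subseteq> layer_labels"
    "X = braid B n (concat (map (layer n) ys))" "Y = braid B n (concat (map (layer n) zs))"
    using assms by (auto simp: qgB_eq)
  then show ?thesis
    unfolding qgB_eq
    by (intro CollectI exI[of _ "ys @ zs"]) (simp add: mult_braid layers_diagrams)
qed

lemma dominant_generators_crossing:
  assumes "n \<ge> 2" "dominant B n x"
  shows "dominant_generators (gB B n) n (crossing ` labels B) (crossing x) (qgB B n)"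
proof
  have x: "x \<in> labels B"
    using assms(2) by (auto simp: dominant_def labels_def)
  show "crossing x \<in> crossing ` labels B"
    using x by blast
  fix a b :: "nat \<Rightarrow> 'a word set" and i j
  assume a: "a \<in> crossing ` labels B"
  then show "a i \<in> carrier (gB B n)"
    using crossing_closed by auto
  from a show "(\<lambda>i. inv\<^bsub>gB B n\<^esub> (a i)) \<in> crossing ` labels B"
    using neg_labels by (force simp: crossing_neg[symmetric])
  show "intertwines (a i) (b j) (b j)" if "b \<in> crossing ` labels B" "i + 1 < j"
    using that a crossing_far crossing_closed by (auto simp: intertwines_def)
  assume i: "1 \<le> i" "i + 1 < n"
  obtain c where c: "c \<in> labels B" "a = crossing c"
    using a by auto
  have
    "braid B n [(x, i), (x, i + 1), (c, i)] = braid B n [(c, i + 1), (x, i), (x, i + 1)]"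
    "braid B n [(x, i + 1), (x, i), (c, i + 1)] = braid B n [(c, i), (x, i + 1), (x, i)]"
    using assms(2) c(1) i unfolding dominant_def by auto
  then show "intertwines (crossing x i \<otimes>\<^bsub>gB B n\<^esub> crossing x (Suc i)) (a (Suc i)) (a i)"
    and "intertwines (crossing x (Suc i) \<otimes>\<^bsub>gB B n\<^esub> crossing x i) (a i) (a (Suc i))"
    using c x i crossing_closed by (simp_all add: intertwines_def braid_Cons braid_Nil m_assoc)
next
  show "qgB B n \<subseteq> carrier (gB B n)"
    by (auto simp: qgB_eq layers_diagrams braid_closed)
next
  fix y :: "nat \<Rightarrow> 'a word set"
  assume "\<And>i. 1 \<le> i \<Longrightarrow> i < n \<Longrightarrow> \<exists>a\<in>crossing ` labels B. y i = a i"
  \<comment> \<open>The sequence may differ from position to position; choosing a label at each one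
    yields a single layer \<open>c\<close>.\<close>
  then have "\<forall>i. \<exists>c. 1 \<le> i \<and> i < n \<longrightarrow> c \<in> labels B \<and> y i = crossing c i"
    by auto
  then obtain c where c: "\<And>i. 1 \<le> i \<Longrightarrow> i < n \<Longrightarrow> c i \<in> labels B \<and> y i = crossing (c i) i"
    by metis
  have "desc y 1 n = desc (\<lambda>i. crossing (c i) i) 1 n"
    by (rule desc_cong) (use c in auto)
  then have "desc y 1 n = braid B n (layer n c)"
    using c by (simp add: braid_layer(2))
  then show "desc y 1 n \<in> qgB B n"
    unfolding qgB_eq using c
    by (intro CollectI exI[of _ "[c]"]) (auto simp: layer_labels_def)
qed (use assms qgB_mult in auto)

lemma subgroup_qgB:
  assumes "n \<ge> 2"
  shows "subgroup (qgB B n) (gB B n)"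
proof -
  obtain x where "dominant B n x"
    using ex_dominant by blast
  then interpret D: dominant_generators "gB B n" n "crossing ` labels B" "crossing x" "qgB B n"
    using assms by (intro dominant_generators_crossing)
  \<comment> \<open>The empty list can serve as base case because the identity is
    quasitoric.\<close>
  have "inv\<^bsub>gB B n\<^esub> (braid B n (concat (map (layer n) ys))) \<in> qgB B n"
    if "set ys \<subseteq> layer_labels" for ys
    using that
  proof (induction ys)
    case Nil
    then show ?case using D.one_in by (simp add: braid_Nil)
  next
    case (Cons y ys)
    then have y: "\<And>i. 1 \<le> i \<Longrightarrow> i < n \<Longrightarrow> y i \<in> labels B"
      by (auto simp: layer_labels_def)
    then have "inv\<^bsub>gB B n\<^esub> (braid B n (layer n y)) \<in> qgB B n"
      using D.inv_layer_in[of "\<lambda>i. crossing (y i) i"] by (auto simp: braid_layer(2))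
    moreover have "braid B n (concat (map (layer n) (y # ys))) =
        braid B n (layer n y) \<otimes>\<^bsub>gB B n\<^esub> braid B n (concat (map (layer n) ys))"
      using Cons.prems y by (simp add: mult_braid braid_layer(1) layers_diagrams)
    ultimately show ?case
      using Cons y qgB_mult
      by (simp add: inv_mult_group braid_closed braid_layer(1) layers_diagrams)
  qed
  then show ?thesis
    using D.Q_sub D.one_in qgB_mult by (intro subgroup.intro) (auto simp: qgB_eq)
qed

end

theorem theorem4p7:
  fixes B :: "'a braid_data" and n :: nat
  assumes "n \<ge> 2"
    and "normal_braid_theory B n"
  shows "subgroup (qgB B n) (gB B n)"
  using assms by (intro normal_braid_theory.subgroup_qgB)

end
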